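(* Let $p=(12,R)$ be the mesh pattern with $R=\{(0,1),(0,2),(1,0),(2,0)\}$. Let $F(x)=\sum_{n\ge0}n!\,x^n$, $F(x,q)=\sum_{n\ge 0}x^n\sum_{\pi\in S_n}q^{p(\pi)}$, and $A(x)=\sum_{n\ge0}|S_n(p)|x^n$. Then, as formal power series in $x$, $$A(x)=\frac{(1+x)F(x)}{1+xF(x)},\qquad F(x,q)=\sum_{i\geq 0}q^{\binom{i}{2}}x^i\prod_{j=0}^{i}\frac{F(q^jx)}{1+xq^jF(q^jx)}.$$
   Context: $S_n$ is the set of permutations $\pi=\pi_1\cdots\pi_n$ of $\{1,\dots,n\}$ ($S_0$ contains only the empty permutation). A mesh pattern $(12,R)$ consists of the permutation $12$ and a set $R\subseteq\{0,1,2\}\times\{0,1,2\}$ of shaded boxes. An occurrence of $(12,R)$ in $\pi\in S_n$ is a pair of positions $s<t$ with $\pi_s<\pi_t$ such that, putting $s_0=0,\ s_1=s,\ s_2=t,\ s_3=n+1$ and $v_0=0,\ v_1=\pi_s,\ v_2=\pi_t,\ v_3=n+1$, for every $(i,j)\in R$ there is no position $m$ with $s_i<m<s_{i+1}$ and $v_j<\pi_m<v_{j+1}$. $p(\pi)$ is the number of occurrences of $p$ in $\pi$, and $S_n(p)$ is the set of $\pi\in S_n$ with $p(\pi)=0$ (permutations avoiding $p$). *)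

theory Defs
  imports
    "HOL-Computational_Algebra.Computational_Algebra"
    "HOL-Combinatorics.Permutations"
begin

definition Sym :: "nat \<Rightarrow> (nat \<Rightarrow> nat) set" where
  "Sym n = {\<pi>. \<pi> permutes {1..n}}"

text \<open>The four lines \<open>0, a, b, n + 1\<close> (indexed by \<open>0, \<dots>, 3\<close>) bounding the columns, or the
  rows, of the mesh that is cut out by two positions, or by two values, \<open>a\<close> and \<open>b\<close>.\<close>

definition mesh_line :: "nat \<Rightarrow> nat \<Rightarrow> nat \<Rightarrow> nat \<Rightarrow> nat" where
  "mesh_line n a b i = [0, a, b, n + 1] ! i"

text \<open>Occurrences of \<open>(12, R)\<close>; a box \<open>(i, j) \<in> R\<close> has column \<open>i\<close> and row \<open>j\<close>, both in
  \<open>{0, 1, 2}\<close>.\<close>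

definition mesh12_occs ::
    "(nat \<times> nat) set \<Rightarrow> nat \<Rightarrow> (nat \<Rightarrow> nat) \<Rightarrow> (nat \<times> nat) set" where
  "mesh12_occs R n \<pi> =
    {(s, t). s \<in> {1..n} \<and> t \<in> {1..n} \<and> s < t \<and> \<pi> s < \<pi> t \<and>
      (\<forall>(i, j) \<in> R. \<not> (\<exists>m \<in> {1..n}.
          mesh_line n s t i < m \<and> m < mesh_line n s t (i + 1) \<and>
          mesh_line n (\<pi> s) (\<pi> t) j < \<pi> m \<and> \<pi> m < mesh_line n (\<pi> s) (\<pi> t) (j + 1)))}"

definition mesh12_count :: "(nat \<times> nat) set \<Rightarrow> nat \<Rightarrow> (nat \<Rightarrow> nat) \<Rightarrow> nat" where
  "mesh12_count R n \<pi> = card (mesh12_occs R n \<pi>)"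

definition mesh12_avoiders :: "(nat \<times> nat) set \<Rightarrow> nat \<Rightarrow> (nat \<Rightarrow> nat) set" where
  "mesh12_avoiders R n = {\<pi> \<in> Sym n. mesh12_count R n \<pi> = 0}"

definition fact_fps :: "'a::field_char_0 fps" where
  "fact_fps = Abs_fps (\<lambda>n. fact n)"

definition mesh12_avoid_fps :: "(nat \<times> nat) set \<Rightarrow> rat fps" where
  "mesh12_avoid_fps R = Abs_fps (\<lambda>n. of_nat (card (mesh12_avoiders R n)))"

definition mesh12_fps :: "(nat \<times> nat) set \<Rightarrow> 'a::comm_ring_1 \<Rightarrow> 'a fps" where
  "mesh12_fps R q = Abs_fps (\<lambda>n. \<Sum>\<pi> \<in> Sym n. q ^ mesh12_count R n \<pi>)"

text \<open>The indeterminate of the field of rational functions over the rationals. Bivariate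
  generating functions are power series in \<open>x\<close> over this field, which contains the polynomials
  in the indeterminate and makes division of power series available.\<close>

definition qvar :: "rat poly fract" where
  "qvar = to_fract [:0, 1:]"

end

theory Submission
  imports Defs
begin

text \<open>
  The four shaded boxes force the first entry of an occurrence to exceed everything to its left and
  to lie below everything to its right. Such an entry is a \<^emph>\<open>strong fixed point\<close>, and it forms an
  occurrence with each later position, so \<open>p(\<pi>)\<close> is the sum of \<open>n - s\<close> over the strong fixed
  points \<open>s\<close> of \<open>\<pi>\<close> (\<open>mesh12_count_eq\<close>).

  Cutting at the first strong fixed point writes a permutation that has one uniquely as
  \<open>\<sigma> \<oplus> 1 \<oplus> \<tau>\<close>, where \<open>\<sigma>\<close> has no strong fixed point and \<open>\<tau>\<close> is arbitrary. If \<open>\<tau>\<close> has size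
  \<open>l\<close>, the cutting point contributes \<open>l\<close> occurrences and the others are those of \<open>\<tau>\<close>. With \<open>B\<close>
  for the generating function of permutations without strong fixed points and \<open>H\<^sub>q(x) = F(x, q)\<close>,
  this is the functional equation \<open>H\<^sub>q(x) = B(x) + x B(x) H\<^sub>q(q x)\<close>
  (\<open>mesh12_fps_functional_equation\<close>), valid for \<open>q\<close> in any commutative ring.

  Everything follows by choosing \<open>q\<close>. At \<open>q = 1\<close> it reads \<open>F = B (1 + x F)\<close>, which determines \<open>B\<close>.
  At \<open>q = 0\<close> only avoiders survive in \<open>H\<^sub>q\<close>, and \<open>H\<^sub>0(0) = 1\<close>, so \<open>A = (1 + x) B\<close>. For the
  indeterminate \<open>q\<close>, substituting the equation into itself \<open>N\<close> times yields the first \<open>N\<close> summands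
  of the claimed series and a remainder divisible by \<open>x\<^sup>N\<close> (\<open>functional_equation_iterate\<close>).
\<close>

section \<open>Occurrences and strong fixed points\<close>

definition strong_fixed_points :: "nat \<Rightarrow> (nat \<Rightarrow> nat) \<Rightarrow> nat set" where
  "strong_fixed_points n \<pi> =
    {s \<in> {1..n}. \<forall>m \<in> {1..n}. (m < s \<longrightarrow> \<pi> m < \<pi> s) \<and> (s < m \<longrightarrow> \<pi> s < \<pi> m)}"

lemma Sym_inj: "\<pi> \<in> Sym n \<Longrightarrow> inj \<pi>"
  by (simp add: Sym_def permutes_inj)

lemma Sym_in_iff: "\<pi> \<in> Sym n \<Longrightarrow> \<pi> m \<in> {1..n} \<longleftrightarrow> m \<in> {1..n}"
  unfolding Sym_def by (simp only: mem_Collect_eq permutes_in_image)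

lemma Sym_outside: "\<pi> \<in> Sym n \<Longrightarrow> m \<notin> {1..n} \<Longrightarrow> \<pi> m = m"
  unfolding Sym_def mem_Collect_eq by (rule permutes_not_in)

lemma SymI:
  assumes "\<And>m. m \<in> {1..n} \<Longrightarrow> \<pi> m \<in> {1..n}" "inj_on \<pi> {1..n}"
    and "\<And>m. m \<notin> {1..n} \<Longrightarrow> \<pi> m = m"
  shows "\<pi> \<in> Sym n"
proof -
  have "\<pi> ` {1..n} = {1..n}"
    using assms(1,2) by (intro endo_inj_surj) auto
  with assms(2) have "bij_betw \<pi> {1..n} {1..n}"
    by (simp add: bij_betw_def)
  from bij_imp_permutes[OF this assms(3)] show ?thesis by (simp add: Sym_def)
qed

lemma finite_Sym: "finite (Sym n)"
  unfolding Sym_def by (rule finite_permutations) simp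

text \<open>Counting: the \<open>s - 1\<close> earlier entries must fit below \<open>\<pi> s\<close> and the \<open>n - s\<close> later ones
  above it, which bounds \<open>\<pi> s\<close> from both sides by \<open>s\<close>.\<close>

lemma strong_fixed_point_fixed:
  assumes "\<pi> \<in> Sym n" and "s \<in> strong_fixed_points n \<pi>"
  shows "\<pi> s = s"
proof -
  have s: "s \<in> {1..n}"
    and below: "\<And>m. m \<in> {1..n} \<Longrightarrow> m < s \<Longrightarrow> \<pi> m < \<pi> s"
    and above: "\<And>m. m \<in> {1..n} \<Longrightarrow> s < m \<Longrightarrow> \<pi> s < \<pi> m"
    using assms(2) by (auto simp: strong_fixed_points_def)
  have val: "\<pi> m \<in> {1..n}" if "m \<in> {1..n}" for m
    using Sym_in_iff[OF assms(1)] that by blast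
  have inj: "inj_on \<pi> A" for A
    using Sym_inj[OF assms(1)] by (rule inj_on_subset) simp
  have "\<pi> ` {1..<s} \<subseteq> {1..<\<pi> s}"
  proof
    fix v assume "v \<in> \<pi> ` {1..<s}"
    then obtain m where m: "m \<in> {1..<s}" "v = \<pi> m" by blast
    then have "m \<in> {1..n}" using s by auto
    with m val[of m] below[of m] show "v \<in> {1..<\<pi> s}" by auto
  qed
  from card_mono[OF _ this] have "s - 1 \<le> \<pi> s - 1"
    by (simp add: card_image[OF inj])
  moreover have "\<pi> ` {s<..n} \<subseteq> {\<pi> s<..n}"
  proof
    fix v assume "v \<in> \<pi> ` {s<..n}"
    then obtain m where m: "m \<in> {s<..n}" "v = \<pi> m" by blast
    then have "m \<in> {1..n}" using s by auto
    with m val[of m] above[of m] show "v \<in> {\<pi> s<..n}" by auto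
  qed
  from card_mono[OF _ this] have "n - s \<le> n - \<pi> s"
    by (simp add: card_image[OF inj])
  ultimately show ?thesis using s val[OF s] by auto
qed

text \<open>The boxes \<open>(0, 1)\<close> and \<open>(0, 2)\<close> say that no earlier entry exceeds \<open>\<pi> s\<close>, and \<open>(1, 0)\<close> and
  \<open>(2, 0)\<close> that no later entry is smaller; the four boxes put no further condition on \<open>t > s\<close>, because
  \<open>\<pi> t\<close> itself is one of the later, larger entries.\<close>

lemma mesh12_occs_eq:
  assumes "\<pi> \<in> Sym n"
  shows "mesh12_occs {(0, 1), (0, 2), (1, 0), (2, 0)} n \<pi> =
    Sigma (strong_fixed_points n \<pi>) (\<lambda>s. {s<..n})"
proof -
  have inj: "\<pi> a = \<pi> b \<longleftrightarrow> a = b" for a b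
    using Sym_inj[OF assms] by (auto dest: injD)
  have val: "1 \<le> \<pi> m \<and> \<pi> m \<le> n" if "1 \<le> m" "m \<le> n" for m
    using Sym_in_iff[OF assms, of m] that by auto
  have lines: "mesh_line n a b 0 = 0" "mesh_line n a b (Suc 0) = a" "mesh_line n a b 1 = a"
      "mesh_line n a b 2 = b" "mesh_line n a b (Suc (Suc 0)) = b" "mesh_line n a b 3 = n + 1" for a b
    by (simp_all add: mesh_line_def numeral_eq_Suc)
  have occ: "(s, t) \<in> mesh12_occs {(0, 1), (0, 2), (1, 0), (2, 0)} n \<pi> \<longleftrightarrow>
      1 \<le> s \<and> s < t \<and> t \<le> n \<and> \<pi> s < \<pi> t \<and>
      (\<forall>m \<in> {1..n}. (m < s \<longrightarrow> \<pi> m \<le> \<pi> s \<or> \<pi> m = \<pi> t) \<and> (s < m \<and> m \<noteq> t \<longrightarrow> \<pi> s \<le> \<pi> m))"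
    (is "?occ s t \<longleftrightarrow> ?conds s t") for s t
  proof -
    \<comment> \<open>With \<open>m\<close> and \<open>\<pi> m\<close> in range, the outer mesh lines \<open>0\<close> and \<open>n + 1\<close> are no constraint, so
      two boxes in the same row or column merge, up to the line that separates them.\<close>
    have box: "(\<not> (0 < m \<and> m < s \<and> \<pi> s < \<pi> m \<and> \<pi> m < \<pi> t)) \<and>
        (\<not> (0 < m \<and> m < s \<and> \<pi> t < \<pi> m \<and> \<pi> m < n + 1)) \<and>
        (\<not> (s < m \<and> m < t \<and> 0 < \<pi> m \<and> \<pi> m < \<pi> s)) \<and>
        (\<not> (t < m \<and> m < n + 1 \<and> 0 < \<pi> m \<and> \<pi> m < \<pi> s)) \<longleftrightarrow>
        (m < s \<longrightarrow> \<pi> m \<le> \<pi> s \<or> \<pi> m = \<pi> t) \<and> (s < m \<and> m \<noteq> t \<longrightarrow> \<pi> s \<le> \<pi> m)"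
      if "s < t" "\<pi> s < \<pi> t" "m \<in> {1..n}" for m
      using val[of m] that by auto
    have "?occ s t \<longleftrightarrow> s \<in> {1..n} \<and> t \<in> {1..n} \<and> s < t \<and> \<pi> s < \<pi> t \<and>
        (\<forall>m \<in> {1..n}. (\<not> (0 < m \<and> m < s \<and> \<pi> s < \<pi> m \<and> \<pi> m < \<pi> t)) \<and>
        (\<not> (0 < m \<and> m < s \<and> \<pi> t < \<pi> m \<and> \<pi> m < n + 1)) \<and>
        (\<not> (s < m \<and> m < t \<and> 0 < \<pi> m \<and> \<pi> m < \<pi> s)) \<and>
        (\<not> (t < m \<and> m < n + 1 \<and> 0 < \<pi> m \<and> \<pi> m < \<pi> s)))"
      by (simp add: mesh12_occs_def lines ball_conj_distrib) auto
    also have "\<dots> \<longleftrightarrow> s \<in> {1..n} \<and> t \<in> {1..n} \<and> s < t \<and> \<pi> s < \<pi> t \<and>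
        (\<forall>m \<in> {1..n}. (m < s \<longrightarrow> \<pi> m \<le> \<pi> s \<or> \<pi> m = \<pi> t) \<and> (s < m \<and> m \<noteq> t \<longrightarrow> \<pi> s \<le> \<pi> m))"
      by (rule conj_cong[OF refl], rule conj_cong[OF refl], rule conj_cong[OF refl],
          rule conj_cong[OF refl], rule ball_cong[OF refl], rule box; assumption)
    also have "\<dots> \<longleftrightarrow> ?conds s t" by auto
    finally show ?thesis .
  qed
  have "(s, t) \<in> mesh12_occs {(0, 1), (0, 2), (1, 0), (2, 0)} n \<pi> \<longleftrightarrow>
      s \<in> strong_fixed_points n \<pi> \<and> t \<in> {s<..n}" (is "?L \<longleftrightarrow> ?R") for s t
  proof
    assume ?L
    then have st: "1 \<le> s" "s < t" "t \<le> n" "\<pi> s < \<pi> t"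
      and boxes: "\<And>m. m \<in> {1..n} \<Longrightarrow>
        (m < s \<longrightarrow> \<pi> m \<le> \<pi> s \<or> \<pi> m = \<pi> t) \<and> (s < m \<and> m \<noteq> t \<longrightarrow> \<pi> s \<le> \<pi> m)"
      unfolding occ by blast+
    have "(m < s \<longrightarrow> \<pi> m < \<pi> s) \<and> (s < m \<longrightarrow> \<pi> s < \<pi> m)" if "m \<in> {1..n}" for m
      using boxes[OF that] inj[of m s] inj[of m t] st by (cases "m = t") auto
    then show ?R using st by (simp add: strong_fixed_points_def)
  next
    assume R: ?R
    then have st: "1 \<le> s" "s < t" "t \<le> n" "t \<in> {1..n}"
      and sfp: "\<And>m. m \<in> {1..n} \<Longrightarrow> (m < s \<longrightarrow> \<pi> m < \<pi> s) \<and> (s < m \<longrightarrow> \<pi> s < \<pi> m)"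
      by (simp_all add: strong_fixed_points_def)
    have "(m < s \<longrightarrow> \<pi> m \<le> \<pi> s \<or> \<pi> m = \<pi> t) \<and> (s < m \<and> m \<noteq> t \<longrightarrow> \<pi> s \<le> \<pi> m)"
      if "m \<in> {1..n}" for m
      using sfp[OF that] by auto
    then show ?L unfolding occ using st sfp[OF st(4)] by simp
  qed
  then show ?thesis by auto
qed

lemma mesh12_count_eq:
  assumes "\<pi> \<in> Sym n"
  shows "mesh12_count {(0, 1), (0, 2), (1, 0), (2, 0)} n \<pi> =
    (\<Sum>s \<in> strong_fixed_points n \<pi>. n - s)"
  unfolding mesh12_count_def mesh12_occs_eq[OF assms]
  by (subst card_SigmaI) (auto simp: strong_fixed_points_def)


section \<open>Splitting at the first strong fixed point\<close>

definition strong_fixed_free :: "nat \<Rightarrow> (nat \<Rightarrow> nat) set" where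
  "strong_fixed_free n = {\<pi> \<in> Sym n. strong_fixed_points n \<pi> = {}}"

definition first_strong_fixed_at :: "nat \<Rightarrow> nat \<Rightarrow> (nat \<Rightarrow> nat) set" where
  "first_strong_fixed_at n s =
    {\<pi> \<in> Sym n. s \<in> strong_fixed_points n \<pi> \<and> strong_fixed_points n \<pi> \<inter> {..<s} = {}}"

text \<open>The direct sum \<open>\<sigma> \<oplus> 1 \<oplus> \<tau>\<close> for \<open>\<sigma>\<close> of size \<open>k\<close>. The middle point \<open>k + 1\<close> falls under the
  second case, as \<open>\<tau> 0 = 0\<close>.\<close>

definition point_sum :: "nat \<Rightarrow> (nat \<Rightarrow> nat) \<Rightarrow> (nat \<Rightarrow> nat) \<Rightarrow> nat \<Rightarrow> nat" where
  "point_sum k \<sigma> \<tau> = (\<lambda>m. if m \<le> k then \<sigma> m else \<tau> (m - (k + 1)) + (k + 1))"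

lemma Sym_le: "\<pi> \<in> Sym n \<Longrightarrow> m \<le> n \<Longrightarrow> \<pi> m \<le> n"
  using Sym_in_iff[of \<pi> n m] Sym_outside[of \<pi> n m] by (cases "m \<in> {1..n}") auto

lemma Sym_0: "\<pi> \<in> Sym n \<Longrightarrow> \<pi> 0 = 0"
  using Sym_outside[of \<pi> n 0] by auto

lemma Sym_pos: "\<pi> \<in> Sym n \<Longrightarrow> 0 < \<pi> m \<longleftrightarrow> 0 < m"
  using Sym_in_iff[of \<pi> n m] Sym_outside[of \<pi> n m] by (cases "m \<in> {1..n}") auto

lemma point_sum_in_Sym:
  assumes \<sigma>: "\<sigma> \<in> Sym k" and \<tau>: "\<tau> \<in> Sym l"
  shows "point_sum k \<sigma> \<tau> \<in> Sym (k + 1 + l)"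
proof (rule SymI)
  fix m assume m: "m \<in> {1..k + 1 + l}"
  show "point_sum k \<sigma> \<tau> m \<in> {1..k + 1 + l}"
  proof (cases "m \<le> k")
    case True
    then have "\<sigma> m \<in> {1..k}" using Sym_in_iff[OF \<sigma>, of m] m by auto
    with True show ?thesis by (simp add: point_sum_def)
  next
    case False
    then have "\<tau> (m - (k + 1)) \<le> l" using m by (intro Sym_le[OF \<tau>]) auto
    with False show ?thesis by (simp add: point_sum_def)
  qed
next
  have "point_sum k \<sigma> \<tau> a \<noteq> point_sum k \<sigma> \<tau> b" if "a < b" for a b
  proof -
    have "\<sigma> a \<noteq> \<sigma> b" using Sym_inj[OF \<sigma>] that by (auto dest: injD)
    moreover have "\<tau> (a - (k + 1)) \<noteq> \<tau> (b - (k + 1))" if "\<not> a \<le> k"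
    proof -
      have "a - (k + 1) \<noteq> b - (k + 1)" using that \<open>a < b\<close> by linarith
      then show ?thesis using Sym_inj[OF \<tau>] by (auto dest: injD)
    qed
    moreover have "\<sigma> a \<le> k" if "a \<le> k" using Sym_le[OF \<sigma> that] .
    ultimately show ?thesis using \<open>a < b\<close>
      by (cases "a \<le> k"; cases "b \<le> k") (auto simp: point_sum_def)
  qed
  then show "inj_on (point_sum k \<sigma> \<tau>) {1..k + 1 + l}"
    by (metis inj_onI linorder_neqE_nat)
next
  fix m assume m: "m \<notin> {1..k + 1 + l}"
  show "point_sum k \<sigma> \<tau> m = m"
  proof (cases "m = 0")
    case True
    then show ?thesis by (simp add: point_sum_def Sym_0[OF \<sigma>])
  next
    case False
    then have "k + 1 + l < m" using m by auto
    then have "\<tau> (m - (k + 1)) = m - (k + 1)" by (intro Sym_outside[OF \<tau>]) auto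
    then show ?thesis using \<open>k + 1 + l < m\<close> by (simp add: point_sum_def)
  qed
qed

lemma strong_fixed_points_point_sum:
  assumes \<sigma>: "\<sigma> \<in> Sym k" and \<tau>: "\<tau> \<in> Sym l"
  shows "strong_fixed_points (k + 1 + l) (point_sum k \<sigma> \<tau>) =
    strong_fixed_points k \<sigma> \<union> insert (k + 1) ((\<lambda>s. s + (k + 1)) ` strong_fixed_points l \<tau>)"
proof (rule set_eqI)
  let ?\<pi> = "point_sum k \<sigma> \<tau>" and ?n = "k + 1 + l"
  have lo: "?\<pi> m = \<sigma> m \<and> \<sigma> m \<le> k" if "m \<le> k" for m
    using that Sym_le[OF \<sigma>] by (simp add: point_sum_def)
  have hi: "?\<pi> (m + (k + 1)) = \<tau> m + (k + 1)" for m
    by (simp add: point_sum_def)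
  fix s
  consider "s = 0" | "1 \<le> s" "s \<le> k" | "s = k + 1" | "k + 1 < s"
    by linarith
  then show "s \<in> strong_fixed_points ?n ?\<pi> \<longleftrightarrow> s \<in> strong_fixed_points k \<sigma> \<union>
      insert (k + 1) ((\<lambda>s. s + (k + 1)) ` strong_fixed_points l \<tau>)"
  proof cases
    case 1
    then show ?thesis by (auto simp: strong_fixed_points_def)
  next
    case 2
    have "?\<pi> s < ?\<pi> m" if "k < m" for m
      using lo[OF 2(2)] hi[of "m - (k + 1)"] that by simp
    note high = this
    have "s \<in> strong_fixed_points ?n ?\<pi> \<longleftrightarrow> s \<in> strong_fixed_points k \<sigma>"
    proof
      assume s: "s \<in> strong_fixed_points ?n ?\<pi>"
      have "(m < s \<longrightarrow> \<sigma> m < \<sigma> s) \<and> (s < m \<longrightarrow> \<sigma> s < \<sigma> m)" if "m \<in> {1..k}" for m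
      proof -
        have "m \<in> {1..?n}" using that by auto
        with s have "(m < s \<longrightarrow> ?\<pi> m < ?\<pi> s) \<and> (s < m \<longrightarrow> ?\<pi> s < ?\<pi> m)"
          unfolding strong_fixed_points_def by blast
        then show ?thesis using lo[of m] lo[of s] that 2 by simp
      qed
      with 2 show "s \<in> strong_fixed_points k \<sigma>" by (auto simp: strong_fixed_points_def)
    next
      assume s: "s \<in> strong_fixed_points k \<sigma>"
      have "(m < s \<longrightarrow> ?\<pi> m < ?\<pi> s) \<and> (s < m \<longrightarrow> ?\<pi> s < ?\<pi> m)" if "m \<in> {1..?n}" for m
      proof (cases "m \<le> k")
        case True
        then have "(m < s \<longrightarrow> \<sigma> m < \<sigma> s) \<and> (s < m \<longrightarrow> \<sigma> s < \<sigma> m)"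
          using s that by (auto simp: strong_fixed_points_def)
        then show ?thesis using lo[of m] lo[of s] True 2 by simp
      next
        case False
        then show ?thesis using high[of m] 2 by simp
      qed
      with 2 show "s \<in> strong_fixed_points ?n ?\<pi>" by (auto simp: strong_fixed_points_def)
    qed
    with 2 show ?thesis by auto
  next
    case 3
    have "?\<pi> s = k + 1" using hi[of 0] 3 Sym_0[OF \<tau>] by simp
    moreover have "?\<pi> m < k + 1" if "m < s" for m using lo[of m] 3 that by simp
    moreover have "k + 1 < ?\<pi> m" if "s < m" for m
      using hi[of "m - (k + 1)"] Sym_pos[OF \<tau>, of "m - (k + 1)"] 3 that by simp
    ultimately show ?thesis using 3 by (auto simp: strong_fixed_points_def)
  next
    case above: 4
    define r where "r = s - (k + 1)"
    have 4: "s = r + (k + 1)" "1 \<le> r" using above by (simp_all add: r_def)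
    have "?\<pi> m < ?\<pi> s" if "m \<le> k + 1" for m
    proof (cases "m \<le> k")
      case True
      then show ?thesis using lo[of m] hi[of r] 4 by simp
    next
      case False
      then have "m = 0 + (k + 1)" using that by simp
      then show ?thesis using hi[of r] hi[of 0] 4 Sym_0[OF \<tau>] Sym_pos[OF \<tau>, of r] by simp
    qed
    note low = this
    have "s \<in> strong_fixed_points ?n ?\<pi> \<longleftrightarrow> r \<in> strong_fixed_points l \<tau>"
    proof
      assume s: "s \<in> strong_fixed_points ?n ?\<pi>"
      have "(m < r \<longrightarrow> \<tau> m < \<tau> r) \<and> (r < m \<longrightarrow> \<tau> r < \<tau> m)" if "m \<in> {1..l}" for m
      proof -
        have "m + (k + 1) \<in> {1..?n}" using that by auto
        with s have "(m + (k + 1) < s \<longrightarrow> ?\<pi> (m + (k + 1)) < ?\<pi> s) \<and>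
            (s < m + (k + 1) \<longrightarrow> ?\<pi> s < ?\<pi> (m + (k + 1)))"
          unfolding strong_fixed_points_def by blast
        then show ?thesis unfolding 4(1) hi by simp
      qed
      with s 4 show "r \<in> strong_fixed_points l \<tau>" by (auto simp: strong_fixed_points_def)
    next
      assume r: "r \<in> strong_fixed_points l \<tau>"
      have "(m < s \<longrightarrow> ?\<pi> m < ?\<pi> s) \<and> (s < m \<longrightarrow> ?\<pi> s < ?\<pi> m)" if "m \<in> {1..?n}" for m
      proof (cases "m \<le> k + 1")
        case True
        then show ?thesis using low 4 by auto
      next
        case False
        define m' where "m' = m - (k + 1)"
        have m': "m = m' + (k + 1)" "m' \<in> {1..l}" using False that by (auto simp: m'_def)
        then have "(m' < r \<longrightarrow> \<tau> m' < \<tau> r) \<and> (r < m' \<longrightarrow> \<tau> r < \<tau> m')"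
          using r by (auto simp: strong_fixed_points_def)
        then show ?thesis unfolding 4(1) m'(1) hi by simp
      qed
      with r 4 show "s \<in> strong_fixed_points ?n ?\<pi>" by (auto simp: strong_fixed_points_def)
    qed
    moreover have "s \<notin> strong_fixed_points k \<sigma>" using 4 by (auto simp: strong_fixed_points_def)
    ultimately show ?thesis using 4 by auto
  qed
qed

text \<open>A strong fixed point \<open>k + 1\<close> is fixed and separates the values \<open>1, \<dots>, k\<close> from the larger
  ones, so both restrictions are permutations again. The strong fixed points of the left one are
  those of \<open>\<pi>\<close> below \<open>k + 1\<close>; therefore \<open>k + 1\<close> is the first one exactly if the left part has
  none.\<close>

lemma bij_betw_point_sum:
  "bij_betw (\<lambda>(\<sigma>, \<tau>). point_sum k \<sigma> \<tau>) (strong_fixed_free k \<times> Sym l)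
    (first_strong_fixed_at (k + 1 + l) (k + 1))"
proof (rule bij_betw_byWitness[where f' = "\<lambda>\<pi>. (\<lambda>m. if m \<le> k then \<pi> m else m,
    \<lambda>m. \<pi> (m + (k + 1)) - (k + 1))"])
  let ?left = "\<lambda>\<pi> m. if m \<le> k then \<pi> m else m"
    and ?right = "\<lambda>\<pi> m. \<pi> (m + (k + 1)) - (k + 1)"
  show "\<forall>p \<in> strong_fixed_free k \<times> Sym l. (\<lambda>\<pi>. (?left \<pi>, ?right \<pi>))
      (case p of (\<sigma>, \<tau>) \<Rightarrow> point_sum k \<sigma> \<tau>) = p"
    by (auto simp: strong_fixed_free_def point_sum_def fun_eq_iff Sym_outside)
  have split: "?left \<pi> \<in> Sym k \<and> ?right \<pi> \<in> Sym l \<and> point_sum k (?left \<pi>) (?right \<pi>) = \<pi>"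
    if \<pi>: "\<pi> \<in> Sym (k + 1 + l)" and sfp: "k + 1 \<in> strong_fixed_points (k + 1 + l) \<pi>" for \<pi>
  proof -
    let ?n = "k + 1 + l"
    have mid: "\<pi> (k + 1) = k + 1" using strong_fixed_point_fixed[OF \<pi> sfp] .
    have lo: "\<pi> m \<in> {1..k}" if "m \<in> {1..k}" for m
    proof -
      have "m \<in> {1..?n}" "m < k + 1" using that by auto
      then have "\<pi> m < \<pi> (k + 1)" using sfp unfolding strong_fixed_points_def by blast
      then show ?thesis using mid Sym_pos[OF \<pi>, of m] that by auto
    qed
    have hi: "\<pi> m \<in> {k + 2..?n}" if "m \<in> {k + 2..?n}" for m
    proof -
      have "m \<in> {1..?n}" "k + 1 < m" using that by auto
      then have "\<pi> (k + 1) < \<pi> m" using sfp unfolding strong_fixed_points_def by blast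
      then show ?thesis using mid Sym_le[OF \<pi>, of m] that by auto
    qed
    have ge: "k + 1 \<le> \<pi> m" if "k + 1 \<le> m" for m
      using hi[of m] mid Sym_outside[OF \<pi>, of m] that
      by (cases "m = k + 1"; cases "m \<le> ?n") auto
    have inj: "\<pi> a = \<pi> b \<longleftrightarrow> a = b" for a b
      using Sym_inj[OF \<pi>] by (auto dest: injD)
    have "?left \<pi> \<in> Sym k"
    proof (rule SymI)
      show "inj_on (?left \<pi>) {1..k}" by (auto simp: inj_on_def inj)
    qed (use lo Sym_0[OF \<pi>] in \<open>auto simp: not_le\<close>)
    moreover have "?right \<pi> \<in> Sym l"
    proof (rule SymI)
      show "?right \<pi> m \<in> {1..l}" if "m \<in> {1..l}" for m
        using hi[of "m + (k + 1)"] that by auto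
      show "inj_on (?right \<pi>) {1..l}"
      proof (rule inj_onI)
        fix a b assume "?right \<pi> a = ?right \<pi> b"
        then have "\<pi> (a + (k + 1)) = \<pi> (b + (k + 1))"
          using ge[of "a + (k + 1)"] ge[of "b + (k + 1)"] by linarith
        then show "a = b" by (simp add: inj)
      qed
      show "?right \<pi> m = m" if "m \<notin> {1..l}" for m
        using that mid Sym_outside[OF \<pi>, of "m + (k + 1)"] by (cases "m = 0") auto
    qed
    moreover have "point_sum k (?left \<pi>) (?right \<pi>) m = \<pi> m" for m
      using ge[of m] by (auto simp: point_sum_def)
    ultimately show ?thesis by blast
  qed
  then show "\<forall>\<pi> \<in> first_strong_fixed_at (k + 1 + l) (k + 1).
      (case (?left \<pi>, ?right \<pi>) of (\<sigma>, \<tau>) \<Rightarrow> point_sum k \<sigma> \<tau>) = \<pi>"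
    by (auto simp: first_strong_fixed_at_def)
  have bound: "s \<le> k" if "s \<in> strong_fixed_points k \<sigma>" for s \<sigma>
    using that by (simp add: strong_fixed_points_def)
  show "(\<lambda>(\<sigma>, \<tau>). point_sum k \<sigma> \<tau>) ` (strong_fixed_free k \<times> Sym l)
      \<subseteq> first_strong_fixed_at (k + 1 + l) (k + 1)"
  proof clarify
    fix \<sigma> \<tau> assume "\<sigma> \<in> strong_fixed_free k" and \<tau>: "\<tau> \<in> Sym l"
    then have \<sigma>: "\<sigma> \<in> Sym k" "strong_fixed_points k \<sigma> = {}"
      by (auto simp: strong_fixed_free_def)
    show "point_sum k \<sigma> \<tau> \<in> first_strong_fixed_at (k + 1 + l) (k + 1)"
      unfolding first_strong_fixed_at_def mem_Collect_eq
        strong_fixed_points_point_sum[OF \<sigma>(1) \<tau>] \<sigma>(2)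
      using point_sum_in_Sym[OF \<sigma>(1) \<tau>] by auto
  qed
  show "(\<lambda>\<pi>. (?left \<pi>, ?right \<pi>)) ` first_strong_fixed_at (k + 1 + l) (k + 1)
      \<subseteq> strong_fixed_free k \<times> Sym l"
  proof
    fix p assume "p \<in> (\<lambda>\<pi>. (?left \<pi>, ?right \<pi>)) ` first_strong_fixed_at (k + 1 + l) (k + 1)"
    then obtain \<pi> where \<pi>: "\<pi> \<in> Sym (k + 1 + l)" "k + 1 \<in> strong_fixed_points (k + 1 + l) \<pi>"
        "strong_fixed_points (k + 1 + l) \<pi> \<inter> {..<k + 1} = {}"
      and p: "p = (?left \<pi>, ?right \<pi>)"
      unfolding first_strong_fixed_at_def by blast
    from split[OF \<pi>(1,2)] have l: "?left \<pi> \<in> Sym k" and r: "?right \<pi> \<in> Sym l"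
      and eq: "point_sum k (?left \<pi>) (?right \<pi>) = \<pi>" by blast+
    have "strong_fixed_points k (?left \<pi>) \<subseteq> strong_fixed_points (k + 1 + l) \<pi>"
      using strong_fixed_points_point_sum[OF l r] unfolding eq by blast
    then have "strong_fixed_points k (?left \<pi>) = {}"
      using \<pi>(3) bound by fastforce
    with l r p show "p \<in> strong_fixed_free k \<times> Sym l"
      by (simp add: strong_fixed_free_def)
  qed
qed

text \<open>The point \<open>k + 1\<close> has \<open>l\<close> positions to its right, and shifting \<open>\<tau>\<close> does not change how many
  positions follow each of its strong fixed points.\<close>

lemma mesh12_count_point_sum:
  assumes \<sigma>: "\<sigma> \<in> strong_fixed_free k" and \<tau>: "\<tau> \<in> Sym l"
  shows "mesh12_count {(0, 1), (0, 2), (1, 0), (2, 0)} (k + 1 + l) (point_sum k \<sigma> \<tau>) =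
    l + mesh12_count {(0, 1), (0, 2), (1, 0), (2, 0)} l \<tau>"
proof -
  have \<sigma>': "\<sigma> \<in> Sym k" "strong_fixed_points k \<sigma> = {}"
    using \<sigma> by (auto simp: strong_fixed_free_def)
  let ?S = "strong_fixed_points l \<tau>"
  have fin: "finite ?S" and notin: "k + 1 \<notin> (\<lambda>s. s + (k + 1)) ` ?S"
    by (auto simp: strong_fixed_points_def)
  have "(\<Sum>s \<in> insert (k + 1) ((\<lambda>s. s + (k + 1)) ` ?S). k + 1 + l - s) =
      l + (\<Sum>s \<in> ?S. l - s)"
    using fin notin by (simp add: sum.reindex inj_on_def)
  then show ?thesis
    using \<sigma>' \<tau> by (simp only: mesh12_count_eq point_sum_in_Sym strong_fixed_points_point_sum Un_empty_left)
qed

lemma Sym_partition: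
  "Sym n = strong_fixed_free n \<union> (\<Union>k \<in> {..<n}. first_strong_fixed_at n (k + 1))"
proof (intro equalityI subsetI)
  fix \<pi> assume \<pi>: "\<pi> \<in> Sym n"
  show "\<pi> \<in> strong_fixed_free n \<union> (\<Union>k \<in> {..<n}. first_strong_fixed_at n (k + 1))"
  proof (cases "strong_fixed_points n \<pi> = {}")
    case True
    with \<pi> show ?thesis by (simp add: strong_fixed_free_def)
  next
    case False
    define s where "s = (LEAST s. s \<in> strong_fixed_points n \<pi>)"
    from False obtain s' where "s' \<in> strong_fixed_points n \<pi>" by blast
    then have s: "s \<in> strong_fixed_points n \<pi>" unfolding s_def by (rule LeastI)
    moreover have "strong_fixed_points n \<pi> \<inter> {..<s} = {}"
      using not_less_Least unfolding s_def by blast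
    ultimately have "\<pi> \<in> first_strong_fixed_at n (s - 1 + 1)" "s - 1 < n"
      using \<pi> by (auto simp: first_strong_fixed_at_def strong_fixed_points_def)
    then show ?thesis by blast
  qed
qed (auto simp: strong_fixed_free_def first_strong_fixed_at_def)

lemma sum_mesh12_recurrence:
  fixes q :: "'a::comm_ring_1"
  defines "cnt \<equiv> mesh12_count {(0, 1), (0, 2), (1, 0), (2, 0)}"
  shows "(\<Sum>\<pi> \<in> Sym n. q ^ cnt n \<pi>) = of_nat (card (strong_fixed_free n)) +
    (\<Sum>k<n. of_nat (card (strong_fixed_free k)) *
      (q ^ (n - 1 - k) * (\<Sum>\<tau> \<in> Sym (n - 1 - k). q ^ cnt (n - 1 - k) \<tau>)))"
proof -
  have fin: "finite (strong_fixed_free n)" "finite (first_strong_fixed_at n s)" for n s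
    by (simp_all add: strong_fixed_free_def first_strong_fixed_at_def finite_Sym)
  have disj: "strong_fixed_free n \<inter> (\<Union>k \<in> {..<n}. first_strong_fixed_at n (k + 1)) = {}"
    by (auto simp: strong_fixed_free_def first_strong_fixed_at_def)
  have disj': "first_strong_fixed_at n s \<inter> first_strong_fixed_at n s' = {}" if "s < s'" for s s'
    using that by (auto simp: first_strong_fixed_at_def)
  have disj'': "first_strong_fixed_at n s \<inter> first_strong_fixed_at n s' = {}" if "s \<noteq> s'" for s s'
    using disj'[of s s'] disj'[of s' s] that by (cases s s' rule: linorder_cases) auto
  have first: "(\<Sum>\<pi> \<in> first_strong_fixed_at n (k + 1). q ^ cnt n \<pi>) =
      of_nat (card (strong_fixed_free k)) *
      (q ^ (n - 1 - k) * (\<Sum>\<tau> \<in> Sym (n - 1 - k). q ^ cnt (n - 1 - k) \<tau>))" if "k < n" for k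
  proof -
    define l where "l = n - 1 - k"
    have n: "n = k + 1 + l" using that by (simp add: l_def)
    have "(\<Sum>\<pi> \<in> first_strong_fixed_at n (k + 1). q ^ cnt n \<pi>) =
        (\<Sum>(\<sigma>, \<tau>) \<in> strong_fixed_free k \<times> Sym l. q ^ cnt n (point_sum k \<sigma> \<tau>))"
      unfolding n
      by (subst sum.reindex_bij_betw[OF bij_betw_point_sum, symmetric]) (simp add: case_prod_beta)
    also have "\<dots> = (\<Sum>(\<sigma>, \<tau>) \<in> strong_fixed_free k \<times> Sym l. q ^ l * q ^ cnt l \<tau>)"
    proof (rule sum.cong[OF refl], clarify)
      fix \<sigma> \<tau> assume "\<sigma> \<in> strong_fixed_free k" "\<tau> \<in> Sym l"
      then show "q ^ cnt n (point_sum k \<sigma> \<tau>) = q ^ l * q ^ cnt l \<tau>"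
        unfolding n cnt_def by (simp only: mesh12_count_point_sum power_add)
    qed
    also have "\<dots> = of_nat (card (strong_fixed_free k)) * (q ^ l * (\<Sum>\<tau> \<in> Sym l. q ^ cnt l \<tau>))"
      by (simp add: sum.cartesian_product[symmetric] sum_distrib_left)
    finally show ?thesis unfolding l_def .
  qed
  have free: "(\<Sum>\<pi> \<in> strong_fixed_free n. q ^ cnt n \<pi>) = of_nat (card (strong_fixed_free n))"
  proof -
    have "q ^ cnt n \<pi> = 1" if "\<pi> \<in> strong_fixed_free n" for \<pi>
    proof -
      have "\<pi> \<in> Sym n" "strong_fixed_points n \<pi> = {}"
        using that by (simp_all add: strong_fixed_free_def)
      then have "cnt n \<pi> = 0" unfolding cnt_def by (simp only: mesh12_count_eq sum.empty)
      then show ?thesis by simp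
    qed
    then show ?thesis by simp
  qed
  have "(\<Sum>\<pi> \<in> (\<Union>k \<in> {..<n}. first_strong_fixed_at n (k + 1)). q ^ cnt n \<pi>) =
      (\<Sum>k<n. \<Sum>\<pi> \<in> first_strong_fixed_at n (k + 1). q ^ cnt n \<pi>)"
  proof (rule sum.UNION_disjoint)
    show "\<forall>i \<in> {..<n}. \<forall>j \<in> {..<n}. i \<noteq> j \<longrightarrow>
        first_strong_fixed_at n (i + 1) \<inter> first_strong_fixed_at n (j + 1) = {}"
      by (intro ballI impI disj'') simp
  qed (simp_all add: fin)
  then have "(\<Sum>\<pi> \<in> Sym n. q ^ cnt n \<pi>) = (\<Sum>\<pi> \<in> strong_fixed_free n. q ^ cnt n \<pi>) +
      (\<Sum>k<n. \<Sum>\<pi> \<in> first_strong_fixed_at n (k + 1). q ^ cnt n \<pi>)"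
    unfolding Sym_partition[of n] using disj by (subst sum.union_disjoint) (simp_all add: fin)
  then show ?thesis using free first by simp
qed


section \<open>The functional equation\<close>

definition strong_fixed_free_fps :: "'a::comm_ring_1 fps" where
  "strong_fixed_free_fps = Abs_fps (\<lambda>n. of_nat (card (strong_fixed_free n)))"

text \<open>Dilating the argument of \<open>H\<close> by \<open>q\<close> supplies the factor \<open>q\<^sup>l\<close> for the occurrences that
  start at the first strong fixed point, where \<open>l\<close> is the size of the part to its right.\<close>

lemma mesh12_fps_functional_equation:
  fixes q :: "'a::comm_ring_1"
  defines "H \<equiv> mesh12_fps {(0, 1), (0, 2), (1, 0), (2, 0)} q"
  shows "H = strong_fixed_free_fps +
    fps_X * strong_fixed_free_fps * (H oo (fps_const q * fps_X))"
proof (rule fps_ext)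
  fix n
  have eq: "H $ n = strong_fixed_free_fps $ n +
      (\<Sum>k<n. strong_fixed_free_fps $ k * (q ^ (n - 1 - k) * H $ (n - 1 - k)))"
    unfolding H_def mesh12_fps_def strong_fixed_free_fps_def fps_nth_Abs_fps
    by (rule sum_mesh12_recurrence)
  also have "(\<Sum>k<n. strong_fixed_free_fps $ k * (q ^ (n - 1 - k) * H $ (n - 1 - k))) =
      (fps_X * (strong_fixed_free_fps * (H oo (fps_const q * fps_X)))) $ n"
    unfolding fps_X_mult_nth
    by (cases n) (simp_all add: fps_mult_nth lessThan_Suc_atMost atLeast0AtMost)
  finally show "H $ n = (strong_fixed_free_fps +
    fps_X * strong_fixed_free_fps * (H oo (fps_const q * fps_X))) $ n"
    by (simp add: mult.assoc)
qed

text \<open>The functional equation at \<open>q = 1\<close>, where every permutation has weight \<open>1\<close> and dilating by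
  \<open>q\<close> does nothing.\<close>

lemma fact_fps_eq:
  "fact_fps = (strong_fixed_free_fps :: 'a::field_char_0 fps) * (1 + fps_X * fact_fps)"
proof -
  have F: "mesh12_fps R 1 = (fact_fps :: 'a fps)" for R
    by (rule fps_ext) (simp add: mesh12_fps_def fact_fps_def Sym_def card_permutations)
  have id: "(f :: 'a fps) oo (fps_const 1 * fps_X) = f" for f
    by (rule fps_ext) (simp only: fps_nth_compose_linear power_one mult_1)
  show ?thesis
    using mesh12_fps_functional_equation[of "1 :: 'a"] unfolding F id
    by (simp add: algebra_simps)
qed

lemma strong_fixed_free_fps_eq:
  "(strong_fixed_free_fps :: 'a::field_char_0 fps) = fact_fps / (1 + fps_X * fact_fps)"
proof -
  have "(1 + fps_X * fact_fps :: 'a fps) $ 0 = 1" by simp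
  then have "(1 + fps_X * fact_fps :: 'a fps) \<noteq> 0" by (metis fps_zero_nth zero_neq_one)
  from nonzero_mult_div_cancel_right[OF this, of strong_fixed_free_fps]
  show ?thesis by (metis fact_fps_eq)
qed

text \<open>At \<open>q = 0\<close> the weight is the indicator function of avoidance, because \<open>0\<^sup>0 = 1\<close>, and the
  dilated series collapses to its constant coefficient. Combinatorially, a strong fixed point in an
  avoider can only be the last position.\<close>

lemma mesh12_avoid_fps_eq:
  "mesh12_avoid_fps {(0, 1), (0, 2), (1, 0), (2, 0)} = (1 + fps_X) * strong_fixed_free_fps"
proof -
  let ?R = "{(0, 1), (0, 2), (1, 0), (2, 0)} :: (nat \<times> nat) set"
  have A: "mesh12_avoid_fps R = mesh12_fps R 0" for R
    by (rule fps_ext) (simp add: mesh12_avoid_fps_def mesh12_fps_def mesh12_avoiders_def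
        power_0_left finite_Sym flip: sum.inter_filter)
  have "Sym 0 = {id}" by (simp add: Sym_def permutes_empty)
  moreover have "mesh12_occs ?R 0 id = {}" by (auto simp: mesh12_occs_def)
  ultimately have "mesh12_fps ?R (0 :: rat) $ 0 = 1"
    by (simp add: mesh12_fps_def mesh12_count_def)
  then have "mesh12_fps ?R (0 :: rat) oo (fps_const 0 * fps_X) = 1"
    by (intro fps_ext) (simp only: fps_nth_compose_linear, simp add: power_0_left)
  with mesh12_fps_functional_equation[of "0 :: rat"] show ?thesis
    unfolding A by (simp add: algebra_simps)
qed


section \<open>Iterating the functional equation\<close>

text \<open>Passing from \<open>N\<close> to \<open>N + 1\<close> substitutes the equation dilated by \<open>q\<^sup>N\<close>, whose factor \<open>x\<close> has
  become \<open>q\<^sup>N x\<close>. After \<open>N\<close> steps these factors multiply to \<open>x\<^sup>N\<close> times \<open>q\<close> to the power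
  \<open>0 + 1 + \<dots> + (N - 1)\<close>, which is the binomial coefficient.\<close>

lemma functional_equation_iterate:
  fixes H B :: "'a::idom fps" and q :: 'a
  assumes H: "H = B + fps_X * B * (H oo (fps_const q * fps_X))"
  shows "H = (\<Sum>i<N. fps_const (q ^ (i choose 2)) * fps_X ^ i *
        (\<Prod>j = 0..i. B oo (fps_const (q ^ j) * fps_X))) +
      fps_const (q ^ (N choose 2)) * fps_X ^ N *
        (\<Prod>j<N. B oo (fps_const (q ^ j) * fps_X)) * (H oo (fps_const (q ^ N) * fps_X))"
proof (induction N)
  case 0
  have "H oo (fps_const 1 * fps_X) = H"
    by (rule fps_ext) (simp only: fps_nth_compose_linear power_one mult_1)
  then show ?case by (simp add: numeral_2_eq_2)
next
  case (Suc N)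
  let ?B = "\<lambda>j. B oo (fps_const (q ^ j) * fps_X)" and ?H = "\<lambda>j. H oo (fps_const (q ^ j) * fps_X)"
  let ?c = "fps_const (q ^ (N choose 2)) * fps_X ^ N * (\<Prod>j<N. ?B j)"
  have comp: "(H oo (fps_const q * fps_X)) oo (fps_const (q ^ N) * fps_X) = ?H (Suc N)"
    by (rule fps_ext)
      (simp only: fps_nth_compose_linear power_Suc power_mult_distrib, simp only: mult_ac)
  have "?H N = (B + fps_X * B * (H oo (fps_const q * fps_X))) oo (fps_const (q ^ N) * fps_X)"
    using H by simp
  also have "\<dots> = ?B N + fps_const (q ^ N) * fps_X * ?B N * ?H (Suc N)"
    by (simp add: fps_compose_add_distrib fps_compose_mult_distrib comp del: fps_nth_compose_linear)
  finally have step: "?c * ?H N = ?c * ?B N + ?c * ?B N * fps_const (q ^ N) * fps_X * ?H (Suc N)"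
    by (simp add: algebra_simps)
  have summand: "?c * ?B N = fps_const (q ^ (N choose 2)) * fps_X ^ N * (\<Prod>j = 0..N. ?B j)"
    by (simp add: atLeast0AtMost lessThan_Suc_atMost[symmetric] mult.assoc)
  have rest: "?c * ?B N * fps_const (q ^ N) * fps_X =
      fps_const (q ^ (Suc N choose 2)) * fps_X ^ Suc N * (\<Prod>j<Suc N. ?B j)"
  proof -
    have "q ^ (Suc N choose 2) = q ^ (N choose 2) * q ^ N"
      by (simp add: numeral_2_eq_2 power_add mult.commute)
    then show ?thesis by (simp add: fps_const_mult[symmetric] mult_ac del: fps_const_mult)
  qed
  show ?case
    using Suc.IH unfolding step rest unfolding summand sum.lessThan_Suc add.assoc .
qed

lemma functional_equation_sums:
  fixes H B :: "'a::idom fps" and q :: 'a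
  assumes H: "H = B + fps_X * B * (H oo (fps_const q * fps_X))"
  shows "(\<lambda>i. fps_const (q ^ (i choose 2)) * fps_X ^ i *
    (\<Prod>j = 0..i. B oo (fps_const (q ^ j) * fps_X))) sums H"
  unfolding sums_def
proof (rule tendsto_fpsI)
  fix n
  let ?term = "\<lambda>i. fps_const (q ^ (i choose 2)) * fps_X ^ i *
    (\<Prod>j = 0..i. B oo (fps_const (q ^ j) * fps_X))"
  have "(\<Sum>i<N. ?term i) $ n = H $ n" if "n < N" for N
  proof -
    let ?rest = "fps_const (q ^ (N choose 2)) *
      (\<Prod>j<N. B oo (fps_const (q ^ j) * fps_X)) * (H oo (fps_const (q ^ N) * fps_X))"
    have "H = (\<Sum>i<N. ?term i) + fps_X ^ N * ?rest"
      using functional_equation_iterate[OF H, of N] by (simp only: mult_ac)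
    from arg_cong[OF this, of "\<lambda>f. f $ n"]
    have "H $ n = (\<Sum>i<N. ?term i) $ n + (fps_X ^ N * ?rest) $ n"
      by (simp only: fps_add_nth)
    then show ?thesis using that by (simp only: fps_X_power_mult_nth if_True add_0_right)
  qed
  then show "eventually (\<lambda>N. (\<Sum>i<N. ?term i) $ n = H $ n) sequentially"
    using eventually_gt_at_top[of n] by (rule eventually_mono[rotated])
qed

theorem theorem3p1:
  fixes R :: "(nat \<times> nat) set"
    and F :: "rat fps"
    and G :: "rat poly fract fps"
    and q :: "rat poly fract"
  defines "R \<equiv> {(0, 1), (0, 2), (1, 0), (2, 0)}"
    and "F \<equiv> fact_fps"
    and "G \<equiv> fact_fps"
    and "q \<equiv> qvar"
  shows "mesh12_avoid_fps R = (1 + fps_X) * F / (1 + fps_X * F) \<and>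
         (\<lambda>i. fps_const (q ^ (i choose 2)) * fps_X ^ i *
            (\<Prod>j = 0..i. (G oo (fps_const (q ^ j) * fps_X)) /
               (1 + fps_X * fps_const (q ^ j) * (G oo (fps_const (q ^ j) * fps_X)))))
          sums mesh12_fps R q"
proof
  have "(1 + fps_X) * F / (1 + fps_X * F) = (1 + fps_X) * (F / (1 + fps_X * F))"
    by (simp add: fps_divide_unit mult.assoc)
  then show "mesh12_avoid_fps R = (1 + fps_X) * F / (1 + fps_X * F)"
    unfolding R_def F_def by (simp only: mesh12_avoid_fps_eq strong_fixed_free_fps_eq)
next
  \<comment> \<open>Dilate \<open>F = B (1 + x F)\<close> and then divide.\<close>
  have dilate: "strong_fixed_free_fps oo (fps_const (q ^ j) * fps_X) =
      (G oo (fps_const (q ^ j) * fps_X)) /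
        (1 + fps_X * fps_const (q ^ j) * (G oo (fps_const (q ^ j) * fps_X)))" for j
  proof -
    let ?B = "strong_fixed_free_fps oo (fps_const (q ^ j) * fps_X)"
      and ?G = "G oo (fps_const (q ^ j) * fps_X)"
    let ?D = "1 + fps_X * fps_const (q ^ j) * ?G"
    have "?G = (strong_fixed_free_fps * (1 + fps_X * G)) oo (fps_const (q ^ j) * fps_X)"
      unfolding G_def using fact_fps_eq by metis
    also have "\<dots> = ?B * ?D"
      by (simp add: fps_compose_add_distrib fps_compose_mult_distrib mult_ac)
    finally have "?G = ?B * ?D" .
    moreover have "?D $ 0 = 1" by (simp add: mult.assoc)
    then have "?D \<noteq> 0" by (metis fps_zero_nth zero_neq_one)
    ultimately show ?thesis by (metis nonzero_mult_div_cancel_right)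
  qed
  show "(\<lambda>i. fps_const (q ^ (i choose 2)) * fps_X ^ i *
      (\<Prod>j = 0..i. (G oo (fps_const (q ^ j) * fps_X)) /
        (1 + fps_X * fps_const (q ^ j) * (G oo (fps_const (q ^ j) * fps_X)))))
      sums mesh12_fps R q"
    using functional_equation_sums[OF mesh12_fps_functional_equation[of q]]
    unfolding R_def dilate .
qed

end
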